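(* Let $N\ge 2$ be an integer, let $\{\tilde\psi_i:0\le i\le N\}$ be the dual Bernstein basis of degree $N$, and let $\mathbb P_N^0=\{u\in\mathbb P_N: u(0)=0,\ u(1)=0\}$. For $0\le i\le N-2$ set $$\psi_i(x)=\tilde\psi_i(x)+a_i\tilde\psi_{i+1}(x)+b_i\tilde\psi_{i+2}(x),\qquad a_i=\frac{2i+4}{N-i+1},\qquad b_i=\frac{(i+2)(i+3)}{(N-i)(N-i+1)}.$$ Then the polynomials $\psi_i$, $0\le i\le N-2$, vanish at $0$ and $1$, and the set $\{\psi_i\}_{i=0}^{N-2}$ is a basis of $\mathbb P_N^0$.
   Context: $\mathbb P_N$ is the space of real polynomials of degree at most $N$. The Bernstein polynomials of degree $N$ on $[0,1]$ are $\phi_i(x)=\binom{N}{i}x^i(1-x)^{N-i}$, $0\le i\le N$. The dual Bernstein polynomials of degree $N$ are $\tilde\psi_i(x)=\sum_{j=0}^N c_{i,j}\phi_j(x)$, $0\le i\le N$, with $$c_{i,j}=\frac{(-1)^{i+j}}{\binom Ni\binom Nj}\sum_{r=0}^{\min(i,j)}(2r+1)\binom{N+r+1}{N-i}\binom{N-r}{N-i}\binom{N+r+1}{N-j}\binom{N-r}{N-j}.$$ They satisfy (known fact) $\int_0^1\phi_i\tilde\psi_j\,dx=\delta_{ij}$ for $0\le i,j\le N$, which characterizes them among polynomials of degree at most $N$. *)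

theory Defs
  imports "HOL-Analysis.Analysis" "HOL-Computational_Algebra.Polynomial"
begin

(* The library has no vector space instance for polynomials, so span and
   linear independence come from this interpretation of the generic locale. *)
interpretation poly_vs: vector_space "smult :: real \<Rightarrow> real poly \<Rightarrow> real poly"
  by unfold_locales (simp_all add: smult_add_left smult_add_right)

definition bernstein_poly :: "nat \<Rightarrow> nat \<Rightarrow> real poly" where
  "bernstein_poly N i = smult (real (N choose i)) ([:0, 1:] ^ i * [:1, -1:] ^ (N - i))"

lemma poly_bernstein_poly: "poly (bernstein_poly N i) x = Bernstein N i x"
  by (simp add: bernstein_poly_def Bernstein_def)

(* Meaningful for i, j \<le> N only; in that range no subtraction on nat truncates. *)
definition dual_bernstein_coeff :: "nat \<Rightarrow> nat \<Rightarrow> nat \<Rightarrow> real" where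
  "dual_bernstein_coeff N i j =
     (-1) ^ (i + j) / (real (N choose i) * real (N choose j)) *
     (\<Sum>r = 0..min i j.
        (2 * real r + 1) *
        real ((N + r + 1) choose (N - i)) * real ((N - r) choose (N - i)) *
        real ((N + r + 1) choose (N - j)) * real ((N - r) choose (N - j)))"

definition dual_bernstein_poly :: "nat \<Rightarrow> nat \<Rightarrow> real poly" where
  "dual_bernstein_poly N i =
     (\<Sum>j = 0..N. smult (dual_bernstein_coeff N i j) (bernstein_poly N j))"

definition coeff_a :: "nat \<Rightarrow> nat \<Rightarrow> real" where
  "coeff_a N i = (2 * real i + 4) / (real N - real i + 1)"

definition coeff_b :: "nat \<Rightarrow> nat \<Rightarrow> real" where
  "coeff_b N i =
     ((real i + 2) * (real i + 3)) / ((real N - real i) * (real N - real i + 1))"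

definition psi :: "nat \<Rightarrow> nat \<Rightarrow> real poly" where
  "psi N i = dual_bernstein_poly N i
     + smult (coeff_a N i) (dual_bernstein_poly N (i + 1))
     + smult (coeff_b N i) (dual_bernstein_poly N (i + 2))"

definition poly_space0 :: "nat \<Rightarrow> real poly set" where
  "poly_space0 N = {u. degree u \<le> N \<and> poly u 0 = 0 \<and> poly u 1 = 0}"

end

(* By the closed forms of the boundary coefficients c(i,0) and c(i,N), the dual polynomials take
   the values (-1)^i (N+1) (N+1 choose i+1) at 0 and (-1)^(i+N) (N+1) (N+1 choose i) at 1, and a_i,
   b_i are chosen so that both values cancel in psi_i.  The coefficient matrix factors as L D L^T
   with L triangular with nonzero diagonal and D = diag (2r+1), so it is invertible.
   The dual polynomials are therefore independent without any appeal to biorthogonality, and the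
   psi_i are independent since they arise from them by a unitriangular change.
   Finally poly_space0 N is x(1-x) times the polynomials of degree at most N-2, so it is spanned by
   N-1 polynomials, and N-1 independent elements must span it. *)
theory Submission
  imports Defs
begin

section \<open>Independence of families\<close>

(* The rank function lets one statement serve for lower and upper triangular matrices. *)
lemma triangular_system_zero:
  fixes T :: "'a \<Rightarrow> 'a \<Rightarrow> 'b::idom" and rank :: "'a \<Rightarrow> nat"
  assumes "finite I"
    and diag: "\<And>k. k \<in> I \<Longrightarrow> T k k \<noteq> 0"
    and tri: "\<And>i k. \<lbrakk>i \<in> I; k \<in> I; i \<noteq> k; T i k \<noteq> 0\<rbrakk> \<Longrightarrow> rank i < rank k"
    and eq: "\<And>k. k \<in> I \<Longrightarrow> (\<Sum>i\<in>I. u i * T i k) = 0"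
    and "k \<in> I"
  shows "u k = 0"
  using \<open>k \<in> I\<close>
proof (induction k rule: measure_induct_rule[of rank])
  case (less k)
  have "(\<Sum>i\<in>I. u i * T i k) = u k * T k k + (\<Sum>i\<in>I - {k}. u i * T i k)"
    using \<open>finite I\<close> less.prems by (rule sum.remove)
  \<comment> \<open>For each remaining \<open>i\<close>, either \<open>T i k\<close> vanishes or
    \<open>i\<close> has smaller rank, and then \<open>u i = 0\<close> by induction.\<close>
  also have "(\<Sum>i\<in>I - {k}. u i * T i k) = 0"
    using less tri by (intro sum.neutral) fastforce
  finally show ?case
    using eq[OF less.prems] diag[OF less.prems] by simp
qed

context vector_space
begin

text \<open>A repeated value \<open>f i = f j\<close> would itself be a nontrivial relation, so the
  scalar criterion yields injectivity too; this is what later allows the members of the family to be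
  counted.\<close>

lemma family_inj_on_independent:
  assumes "finite I"
    and zero: "\<And>u i. \<lbrakk>(\<Sum>i\<in>I. scale (u i) (f i)) = 0; i \<in> I\<rbrakk> \<Longrightarrow> u i = 0"
  shows "inj_on f I" and "independent (f ` I)"
proof -
  show inj: "inj_on f I"
  proof (rule inj_onI, rule ccontr)
    fix i j assume ij: "i \<in> I" "j \<in> I" "f i = f j" "i \<noteq> j"
    define u where "u = (\<lambda>k. if k = i then 1 else if k = j then - 1 else (0::'a))"
    have "(\<Sum>k\<in>I. scale (u k) (f k)) = (\<Sum>k\<in>{i, j}. scale (u k) (f k))"
      using ij \<open>finite I\<close> by (intro sum.mono_neutral_right) (auto simp: u_def)
    also have "\<dots> = 0"
      using ij by (simp add: u_def)
    finally have "u i = 0"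
      using zero ij by blast
    then show False
      by (simp add: u_def)
  qed
  show "independent (f ` I)"
  proof (rule independent_if_scalars_zero)
    fix u x assume *: "(\<Sum>x\<in>f ` I. scale (u x) x) = 0" "x \<in> f ` I"
    then obtain i where i: "i \<in> I" "x = f i" by blast
    have "(\<Sum>i\<in>I. scale ((u \<circ> f) i) (f i)) = 0"
      using * inj by (simp add: sum.reindex)
    then show "u x = 0"
      using zero i by fastforce
  qed (use \<open>finite I\<close> in simp)
qed

text \<open>When the \<open>g j\<close> are independent, this turns a relation among the combined
  vectors into the linear system \<open>u T = 0\<close>.\<close>

lemma family_change_of_basis:
  "(\<Sum>i\<in>I. scale (u i) (\<Sum>j\<in>J. scale (T i j) (g j))) = (\<Sum>j\<in>J. scale (\<Sum>i\<in>I. u i * T i j) (g j))"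
proof -
  have "(\<Sum>i\<in>I. scale (u i) (\<Sum>j\<in>J. scale (T i j) (g j))) = (\<Sum>i\<in>I. \<Sum>j\<in>J. scale (u i * T i j) (g j))"
    by (simp add: scale_sum_right)
  also have "\<dots> = (\<Sum>j\<in>J. \<Sum>i\<in>I. scale (u i * T i j) (g j))"
    by (rule sum.swap)
  finally show ?thesis
    by (simp add: scale_sum_left)
qed

text \<open>By Steinitz exchange an independent set inside \<open>span B\<close> has at most
  \<open>card B\<close> elements, so \<open>A\<close> cannot be enlarged within
  \<open>S\<close>.\<close>

lemma independent_card_span_eq:
  assumes "finite B" "independent A" "A \<subseteq> S" "S \<subseteq> span B" "subspace S" "card B \<le> card A"
  shows "span A = S"
proof
  show "span A \<subseteq> S"
    using assms by (intro span_minimal)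
  have "finite A"
    using independent_span_bound[of B A] assms by blast
  show "S \<subseteq> span A"
  proof (rule subsetI, rule ccontr)
    fix x assume x: "x \<in> S" "x \<notin> span A"
    then have "independent (insert x A)" "x \<notin> A"
      using assms by (auto simp: independent_insert span_base)
    moreover have "insert x A \<subseteq> span B"
      using assms x by blast
    ultimately have "card (insert x A) \<le> card B"
      using independent_span_bound assms by blast
    then show False
      using \<open>finite A\<close> \<open>x \<notin> A\<close> assms by simp
  qed
qed

end

section \<open>Bernstein and dual Bernstein polynomials\<close>

lemma poly_bernstein_poly_0: "poly (bernstein_poly N j) 0 = (if j = 0 then 1 else 0)"
  by (simp add: bernstein_poly_def)

lemma poly_bernstein_poly_1:
  "j \<le> N \<Longrightarrow> poly (bernstein_poly N j) 1 = (if j = N then 1 else 0)"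
  by (simp add: bernstein_poly_def)

lemma degree_bernstein_poly_le:
  assumes "j \<le> N"
  shows "degree (bernstein_poly N j) \<le> N"
proof -
  have "degree ([:0, 1:] ^ j * [:1, -1:] ^ (N - j) :: real poly) \<le> 1 * j + 1 * (N - j)"
    by (intro order.trans[OF degree_mult_le] add_mono order.trans[OF degree_power_le]) auto
  then show ?thesis
    unfolding bernstein_poly_def using assms order.trans[OF degree_smult_le] by fastforce
qed

lemma coeff_bernstein_poly:
  "coeff (bernstein_poly N j) k =
    (if k < j then 0 else real (N choose j) * coeff ([:1, -1:] ^ (N - j)) (k - j))"
proof -
  have "[:0, 1:] ^ j = monom (1::real) j"
    by (simp add: monom_altdef)
  then show ?thesis
    by (simp add: bernstein_poly_def coeff_monom_mult)
qed

lemma coeff_bernstein_poly_self: "coeff (bernstein_poly N j) j = real (N choose j)"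
  by (simp add: coeff_bernstein_poly coeff_0_power)

text \<open>The \<open>j\<close>-th Bernstein polynomial is divisible by x^j, so its monomial
  coefficients form a triangular matrix with the binomials \<open>N choose j\<close> on the
  diagonal.\<close>

lemma bernstein_poly_family_zero:
  assumes "(\<Sum>j=0..N. smult (u j) (bernstein_poly N j)) = 0" "j \<in> {0..N}"
  shows "u j = 0"
proof (rule triangular_system_zero[where I = "{0..N}" and rank = id
      and T = "\<lambda>j k. coeff (bernstein_poly N j) k"])
  fix k
  have "coeff (\<Sum>j=0..N. smult (u j) (bernstein_poly N j)) k = 0"
    using assms by simp
  then show "(\<Sum>j=0..N. u j * coeff (bernstein_poly N j) k) = 0"
    by (simp add: coeff_sum)
next
  fix i k assume "i \<noteq> k" "coeff (bernstein_poly N i) k \<noteq> 0"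
  then show "id i < id k"
    by (auto simp: coeff_bernstein_poly split: if_splits)
qed (use assms in \<open>auto simp: coeff_bernstein_poly_self\<close>)

text \<open>The entry in row \<open>i\<close> and column \<open>r\<close> of the factor L in L D
  L^T.\<close>

definition dual_factor :: "nat \<Rightarrow> nat \<Rightarrow> nat \<Rightarrow> real" where
  "dual_factor N i r =
     (-1) ^ i / real (N choose i) * real ((N + r + 1) choose (N - i)) * real ((N - r) choose (N - i))"

lemma dual_factor_eq_0: "\<lbrakk>i < r; r \<le> N\<rbrakk> \<Longrightarrow> dual_factor N i r = 0"
  using binomial_eq_0[of "N - r" "N - i"] by (simp add: dual_factor_def diff_less_mono2)

lemma dual_factor_diag_nonzero: "i \<le> N \<Longrightarrow> dual_factor N i i \<noteq> 0"
  by (simp add: dual_factor_def)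

lemma dual_bernstein_coeff_factor:
  assumes "i \<le> N" "j \<le> N"
  shows "dual_bernstein_coeff N i j =
    (\<Sum>r=0..N. (2 * real r + 1) * dual_factor N i r * dual_factor N j r)"
proof -
  have "dual_bernstein_coeff N i j =
      (\<Sum>r=0..min i j. (2 * real r + 1) * dual_factor N i r * dual_factor N j r)"
    unfolding dual_bernstein_coeff_def dual_factor_def sum_distrib_left
    by (intro sum.cong) (simp_all add: power_add)
  \<comment> \<open>Beyond \<open>min i j\<close> one of the two factors is above the diagonal of L,
    hence zero.\<close>
  also have "\<dots> = (\<Sum>r=0..N. (2 * real r + 1) * dual_factor N i r * dual_factor N j r)"
    using assms by (intro sum.mono_neutral_left) (auto simp: dual_factor_eq_0 min_def split: if_splits)
  finally show ?thesis .
qed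

lemma dual_bernstein_poly_family_zero:
  assumes "(\<Sum>i=0..N. smult (u i) (dual_bernstein_poly N i)) = 0" "i \<in> {0..N}"
  shows "u i = 0"
proof -
  \<comment> \<open>\<open>v\<close> is the row vector u L D. The system u L D L^T = 0 is solved in
    two stages: first \<open>v = 0\<close> from the triangular L^T, then \<open>u = 0\<close> from
    L.\<close>
  define v where "v r = (2 * real r + 1) * (\<Sum>i=0..N. u i * dual_factor N i r)" for r
  have "(\<Sum>j=0..N. smult (\<Sum>i=0..N. u i * dual_bernstein_coeff N i j) (bernstein_poly N j)) = 0"
    using assms(1) by (simp add: dual_bernstein_poly_def poly_vs.family_change_of_basis)
  then have c: "(\<Sum>i=0..N. u i * dual_bernstein_coeff N i j) = 0" if "j \<in> {0..N}" for j
    using bernstein_poly_family_zero[where N = N and u = "\<lambda>j. \<Sum>i=0..N. u i * dual_bernstein_coeff N i j"] that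
    by blast
  have vL: "(\<Sum>r=0..N. v r * dual_factor N j r) = 0" if "j \<in> {0..N}" for j
  proof -
    have "(\<Sum>r=0..N. v r * dual_factor N j r) =
        (\<Sum>r=0..N. \<Sum>i=0..N. u i * ((2 * real r + 1) * dual_factor N i r * dual_factor N j r))"
      by (simp add: v_def sum_distrib_left sum_distrib_right mult_ac)
    also have "\<dots> =
        (\<Sum>i=0..N. \<Sum>r=0..N. u i * ((2 * real r + 1) * dual_factor N i r * dual_factor N j r))"
      by (rule sum.swap)
    also have "\<dots> = (\<Sum>i=0..N. u i * dual_bernstein_coeff N i j)"
      using that by (simp add: dual_bernstein_coeff_factor sum_distrib_left)
    finally show ?thesis
      using c[OF that] by simp
  qed
  have v0: "v r = 0" if "r \<in> {0..N}" for r
    by (rule triangular_system_zero[where I = "{0..N}" and rank = id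
          and T = "\<lambda>r j. dual_factor N j r"])
      (use that vL dual_factor_eq_0 in \<open>auto simp: dual_factor_diag_nonzero intro: ccontr\<close>)
  show ?thesis
  \<comment> \<open>L is lower triangular, so the substitution runs downwards from
    \<open>i = N\<close>; hence the reversed rank.\<close>
  proof (rule triangular_system_zero[where I = "{0..N}" and rank = "\<lambda>i. N - i"
          and T = "dual_factor N"])
    fix r assume "r \<in> {0..N}"
    from v0[OF this] show "(\<Sum>i=0..N. u i * dual_factor N i r) = 0"
      by (simp add: v_def add_nonneg_eq_0_iff)
  next
    fix i k assume "i \<in> {0..N}" "k \<in> {0..N}" "i \<noteq> k" "dual_factor N i k \<noteq> 0"
    then show "N - i < N - k"
      using dual_factor_eq_0[of i k N] by (cases "i < k") auto
  qed (use assms in \<open>auto simp: dual_factor_diag_nonzero\<close>)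
qed

section \<open>Boundary values\<close>

text \<open>Only the Bernstein polynomial of index 0 survives at 0, and the sum defining c(i,0) has
  the single term r = 0.\<close>

lemma dual_bernstein_poly_at_0:
  assumes "i \<le> N"
  shows "poly (dual_bernstein_poly N i) 0 = (-1) ^ i * real (N + 1) * real ((N + 1) choose (i + 1))"
proof -
  have "poly (dual_bernstein_poly N i) 0 = dual_bernstein_coeff N i 0"
    by (simp add: dual_bernstein_poly_def poly_sum poly_bernstein_poly_0 mult_delta_right)
  also have "\<dots> = (-1) ^ i * real (N + 1) * real ((N + 1) choose (i + 1))"
  proof -
    have "(N + 1) choose (N - i) = (N + 1) choose (i + 1)" "N choose (N - i) = N choose i"
      using assms binomial_symmetric[of "i + 1" "N + 1"] binomial_symmetric[of i N] by simp_all
    then show ?thesis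
      using assms by (simp add: dual_bernstein_coeff_def)
  qed
  finally show ?thesis .
qed

lemma binomial_absorb_real:
  "real (k + 1) * real (n choose (k + 1)) = (real n - real k) * real (n choose k)"
  using gbinomial_mult_1[of "real n" k] by (simp add: binomial_gbinomial algebra_simps)

lemma Suc_times_binomial_real:
  "real (k + 1) * real ((n + 1) choose (k + 1)) = real (n + 1) * real (n choose k)"
  using Suc_times_binomial[of k n] by (simp del: binomial_Suc_Suc of_nat_Suc flip: of_nat_mult)

(* Gosper's algorithm finds this antidifference of (2r+1) (N+r+1 choose k) (N-r choose k). *)
lemma binomial_product_telescope:
  fixes N k m :: nat
  assumes "m \<le> N + 1"
  shows "(\<Sum>r<m. (2 * real r + 1) * real ((N + r + 1) choose k) * real ((N - r) choose k))
    = real (k + 1) * (real ((N + 1) choose (k + 1)) ^ 2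
        - real ((N + m + 1) choose (k + 1)) * real ((N + 1 - m) choose (k + 1)))"
  using assms
proof (induction m)
  case 0
  then show ?case by (simp add: power2_eq_square)
next
  case (Suc m)
  define A where "A = real ((N + m + 1) choose k)"
  define B where "B = real ((N - m) choose k)"
  have e: "N + 1 - m = Suc (N - m)" using Suc.prems by simp
  have h1: "real (k + 1) * real ((N + m + 1) choose (k + 1)) = (real N + real m + 1 - real k) * A"
    using binomial_absorb_real[of k "N + m + 1"] by (simp add: A_def)
  have h2: "real (k + 1) * real ((N - m) choose (k + 1)) = (real N - real m - real k) * B"
    using binomial_absorb_real[of k "N - m"] Suc.prems by (simp add: B_def of_nat_diff)
  have h3: "real (k + 1) * real ((N + Suc m + 1) choose (k + 1)) = (real N + real m + 2) * A"
    using Suc_times_binomial_real[of k "N + m + 1"] by (simp add: A_def add_ac del: binomial_Suc_Suc)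
  have h4: "real (k + 1) * real ((N + 1 - m) choose (k + 1)) = (real N - real m + 1) * B"
    using Suc_times_binomial_real[of k "N - m"] Suc.prems
    unfolding e by (simp add: B_def of_nat_diff del: binomial_Suc_Suc)
  let ?P = "real ((N + m + 1) choose (k + 1)) * real ((N + 1 - m) choose (k + 1))"
  let ?Q = "real ((N + Suc m + 1) choose (k + 1)) * real ((N - m) choose (k + 1))"
  \<comment> \<open>One factor \<open>k + 1\<close> is absorbed by each binomial. The rest is the
    identity (N+m+1-k)(N-m+1) - (N+m+2)(N-m-k) = (k+1)(2m+1).\<close>
  have "real (k + 1) * (real (k + 1) * (?P - ?Q)) =
     (real (k + 1) * real ((N + m + 1) choose (k + 1))) * (real (k + 1) * real ((N + 1 - m) choose (k + 1)))
     - (real (k + 1) * real ((N + Suc m + 1) choose (k + 1))) * (real (k + 1) * real ((N - m) choose (k + 1)))"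
    by (simp only: algebra_simps)
  also have "\<dots> = real (k + 1) * ((2 * real m + 1) * A * B)"
    unfolding h1 h2 h3 h4 by (simp add: algebra_simps)
  finally have "real (k + 1) * (?P - ?Q) = (2 * real m + 1) * A * B"
    by (subst (asm) mult_cancel_left) simp
  with Suc show ?case
    by (simp add: A_def B_def right_diff_distrib)
qed

text \<open>Only the index N survives at 1; in c(i,N) the binomials belonging to j = N equal 1,
  which leaves a sum that telescopes.\<close>

lemma dual_bernstein_poly_at_1:
  assumes "i \<le> N"
  shows "poly (dual_bernstein_poly N i) 1 = (-1) ^ (i + N) * real (N + 1) * real ((N + 1) choose i)"
proof -
  let ?k = "N - i"
  have "poly (dual_bernstein_poly N i) 1 =
      (\<Sum>j=0..N. if j = N then dual_bernstein_coeff N i j else 0)"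
    unfolding dual_bernstein_poly_def poly_sum
    by (intro sum.cong) (auto simp: poly_bernstein_poly_1)
  also have "\<dots> = dual_bernstein_coeff N i N"
    by (simp add: sum.delta)
  also have "\<dots> = (-1) ^ (i + N) / real (N choose i) *
      (\<Sum>r<i + 1. (2 * real r + 1) * real ((N + r + 1) choose ?k) * real ((N - r) choose ?k))"
    using assms by (simp add: dual_bernstein_coeff_def min_def atLeast0AtMost lessThan_Suc_atMost)
  \<comment> \<open>At \<open>m = i + 1\<close> the upper endpoint contains
    \<open>(N - i) choose (N - i + 1) = 0\<close>.\<close>
  also have "(\<Sum>r<i + 1. (2 * real r + 1) * real ((N + r + 1) choose ?k) * real ((N - r) choose ?k))
      = real (?k + 1) * real ((N + 1) choose (?k + 1)) ^ 2"
    using assms by (subst binomial_product_telescope) (auto simp: binomial_eq_0)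
  also have "\<dots> = real (N + 1) * real (N choose i) * real ((N + 1) choose i)"
  proof -
    have "real (?k + 1) * real ((N + 1) choose (?k + 1)) = real (N + 1) * real (N choose ?k)"
      by (rule Suc_times_binomial_real)
    moreover have "(N + 1) choose (?k + 1) = (N + 1) choose i" "N choose ?k = N choose i"
      using assms binomial_symmetric[of i "N + 1"] binomial_symmetric[of i N]
      by (simp_all add: Suc_diff_le)
    ultimately show ?thesis
      by (simp add: power2_eq_square del: binomial_Suc_Suc)
  qed
  finally show ?thesis
    using assms by simp
qed

lemma poly_psi_boundary:
  assumes "i + 2 \<le> N"
  shows "poly (psi N i) 0 = 0" and "poly (psi N i) 1 = 0"
proof -
  define d where "d = real N - real i"
  have d: "d \<ge> 2" using assms by (simp add: d_def)
  define B where "B k = real ((N + 1) choose k)" for k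
  have B: "B (k + 1) = (real N + 1 - real k) * B k / (real k + 1)" for k
    using binomial_absorb_real[of k "N + 1"] by (simp add: B_def field_simps)
  have B1: "B (i + 1) = (d + 1) * B i / (real i + 1)"
    using B[of i] by (simp add: d_def algebra_simps)
  have B2: "B (i + 2) = d * B (i + 1) / (real i + 2)"
    using B[of "i + 1"] by (simp add: d_def algebra_simps)
  have B3: "B (i + 3) = (d - 1) * B (i + 2) / (real i + 3)"
    using B[of "i + 2"] by (simp add: d_def algebra_simps eval_nat_numeral)
  have a: "coeff_a N i = 2 * (real i + 2) / (d + 1)"
    and b: "coeff_b N i = (real i + 2) * (real i + 3) / (d * (d + 1))"
    by (simp_all add: coeff_a_def coeff_b_def d_def algebra_simps)
  have "poly (psi N i) 0 =
      (-1) ^ i * real (N + 1) * (B (i + 1) - coeff_a N i * B (i + 2) + coeff_b N i * B (i + 3))"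
    using assms by (simp add: psi_def dual_bernstein_poly_at_0 B_def algebra_simps eval_nat_numeral)
  \<comment> \<open>With \<open>B (i + 1)\<close> factored out, this is 1 - 2d/(d+1) + (d-1)/(d+1) =
    0.\<close>
  also have "B (i + 1) - coeff_a N i * B (i + 2) + coeff_b N i * B (i + 3) = 0"
    unfolding B3 B2 a b using d by (simp add: divide_simps) (simp add: algebra_simps)
  finally show "poly (psi N i) 0 = 0" by simp
  have "poly (psi N i) 1 =
      (-1) ^ (i + N) * real (N + 1) * (B i - coeff_a N i * B (i + 1) + coeff_b N i * B (i + 2))"
    using assms by (simp add: psi_def dual_bernstein_poly_at_1 B_def algebra_simps eval_nat_numeral)
  \<comment> \<open>With \<open>B i\<close> factored out, this is 1 - 2(i+2)/(i+1) + (i+3)/(i+1) =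
    0.\<close>
  also have "B i - coeff_a N i * B (i + 1) + coeff_b N i * B (i + 2) = 0"
    unfolding B2 B1 a b using d by (simp add: divide_simps) (simp add: algebra_simps)
  finally show "poly (psi N i) 1 = 0" by simp
qed

section \<open>The basis of the space with boundary conditions\<close>

lemma degree_psi_le:
  assumes "i + 2 \<le> N"
  shows "degree (psi N i) \<le> N"
proof -
  have "degree (dual_bernstein_poly N k) \<le> N" for k
    unfolding dual_bernstein_poly_def
    by (intro degree_sum_le) (auto intro: order.trans[OF degree_smult_le] degree_bernstein_poly_le)
  then show ?thesis
    unfolding psi_def by (intro degree_add_le order.trans[OF degree_smult_le])
qed

lemma psi_family_zero:
  assumes "N \<ge> 2" "(\<Sum>i=0..N - 2. smult (u i) (psi N i)) = 0" "i \<in> {0..N - 2}"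
  shows "u i = 0"
proof -
  \<comment> \<open>Row \<open>i\<close> holds the coordinates 1, a_i, b_i of \<open>psi N i\<close>
    in the dual basis.\<close>
  define T where "T i k = (if k = i then 1 else 0) + (if k = i + 1 then coeff_a N i else 0)
     + (if k = i + 2 then coeff_b N i else 0)" for i k
  have psi: "psi N i = (\<Sum>k=0..N. smult (T i k) (dual_bernstein_poly N k))"
    if "i \<in> {0..N - 2}" for i
  proof -
    have *: "(\<Sum>k=0..N. smult (if k = m then c else 0) (dual_bernstein_poly N k)) =
        smult c (dual_bernstein_poly N m)" if "m \<le> N" for m c
    proof -
      have "(\<Sum>k=0..N. smult (if k = m then c else 0) (dual_bernstein_poly N k)) =
        (\<Sum>k=0..N. if k = m then smult c (dual_bernstein_poly N k) else 0)"
        by (intro sum.cong) auto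
      then show ?thesis
        using that by (simp add: sum.delta)
    qed
    have "i \<le> N" "i + 1 \<le> N" "i + 2 \<le> N"
      using that assms(1) by auto
    then show ?thesis
      by (simp only: T_def smult_add_left sum.distrib * psi_def smult_1_left)
  qed
  have "(\<Sum>k=0..N. smult (\<Sum>i=0..N - 2. u i * T i k) (dual_bernstein_poly N k)) = 0"
    using assms(2) by (simp add: psi poly_vs.family_change_of_basis)
  then have eq: "(\<Sum>i=0..N - 2. u i * T i k) = 0" if "k \<in> {0..N}" for k
    using dual_bernstein_poly_family_zero[where N = N and u = "\<lambda>k. \<Sum>i=0..N - 2. u i * T i k"] that by blast
  show ?thesis
    \<comment> \<open>The columns up to \<open>N - 2\<close> alone form a square upper unitriangular
      system.\<close>
    by (rule triangular_system_zero[where I = "{0..N - 2}" and rank = id and T = T])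
      (use assms eq in \<open>auto simp: T_def split: if_splits\<close>)
qed

lemma poly_space0_subset_span:
  assumes "N \<ge> 2"
  shows "poly_space0 N \<subseteq> poly_vs.span ((\<lambda>k. [:0, 1, -1:] * monom 1 k) ` {0..N - 2})"
proof
  fix u assume "u \<in> poly_space0 N"
  then have u: "degree u \<le> N" "poly u 0 = 0" "poly u 1 = 0"
    by (auto simp: poly_space0_def)
  from u(2) obtain v where v: "u = [:0, 1:] * v"
    by (auto simp: poly_eq_0_iff_dvd)
  with u(3) have "poly v 1 = 0"
    by simp
  then obtain w where w: "v = [:-1, 1:] * w"
    by (auto simp: poly_eq_0_iff_dvd)
  \<comment> \<open>The sign turns the factor x(x-1) into x(1-x).\<close>
  define q where "q = - w"
  have uq: "u = [:0, 1, -1:] * q"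
    by (simp add: v w q_def)
  have "degree q \<le> N - 2"
  proof (cases "q = 0")
    case False
    then have "degree u = 2 + degree q"
      unfolding uq by (subst degree_mult_eq) auto
    then show ?thesis using u(1) by simp
  qed simp
  then have "q = (\<Sum>k=0..N - 2. smult (coeff q k) (monom 1 k))"
    by (simp add: poly_as_sum_of_monoms' smult_monom atLeast0AtMost)
  then have "u = [:0, 1, -1:] * (\<Sum>k=0..N - 2. smult (coeff q k) (monom 1 k))"
    using uq by simp
  also have "\<dots> = (\<Sum>k=0..N - 2. smult (coeff q k) ([:0, 1, -1:] * monom 1 k))"
    unfolding sum_distrib_left by (simp only: mult_smult_right)
  also have "\<dots> \<in> poly_vs.span ((\<lambda>k. [:0, 1, -1:] * monom 1 k) ` {0..N - 2})"
    by (intro poly_vs.span_sum poly_vs.span_scale poly_vs.span_base imageI)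
  finally show "u \<in> poly_vs.span ((\<lambda>k. [:0, 1, -1:] * monom 1 k) ` {0..N - 2})" .
qed

lemma subspace_poly_space0: "poly_vs.subspace (poly_space0 N)"
  by (auto simp: poly_vs.subspace_def poly_space0_def
      intro: degree_add_le order.trans[OF degree_smult_le])

theorem proposition1:
  fixes N :: nat
  assumes "N \<ge> 2"
  shows "(\<forall>i \<in> {0..N - 2}. poly (psi N i) 0 = 0 \<and> poly (psi N i) 1 = 0) \<and>
         inj_on (psi N) {0..N - 2} \<and>
         poly_vs.independent (psi N ` {0..N - 2}) \<and>
         poly_vs.span (psi N ` {0..N - 2}) = poly_space0 N"
proof -
  have le: "i + 2 \<le> N" if "i \<in> {0..N - 2}" for i
    using that assms by auto
  have inj: "inj_on (psi N) {0..N - 2}" and indep: "poly_vs.independent (psi N ` {0..N - 2})"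
    using poly_vs.family_inj_on_independent[of "{0..N - 2}" "psi N"] psi_family_zero[OF assms]
    by blast+
  have "poly_vs.span (psi N ` {0..N - 2}) = poly_space0 N"
  proof (rule poly_vs.independent_card_span_eq)
    show "psi N ` {0..N - 2} \<subseteq> poly_space0 N"
      using le degree_psi_le poly_psi_boundary by (auto simp: poly_space0_def)
    \<comment> \<open>Both families are indexed by the same set, and \<open>psi N\<close> is
      injective on it.\<close>
    show "card ((\<lambda>k. [:0, 1, -1:] * monom (1::real) k) ` {0..N - 2}) \<le> card (psi N ` {0..N - 2})"
      unfolding card_image[OF inj] by (rule card_image_le) simp
  qed (use indep subspace_poly_space0 poly_space0_subset_span[OF assms] in auto)
  then show ?thesis
    using le poly_psi_boundary inj indep by blast
qed

end
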